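(* Let $EDP$ denote the exit-distance polynomial (a polynomial in $x$) and $LLL$ the level of the lowest leaf of a rooted tree, and write $S(n)=S(\tau(n))$ for each of these statistics $S$, where $\tau(n)$ is the rooted tree with Matula number $n$. Then for every positive integer $n$, $$EDP(n)=\begin{cases}1, & \text{if } n=1;\\ EDP(t)+x^{1+LLL(t)}, & \text{if } n=p_t \text{ with } t\ge 1;\\ EDP(r)+EDP(s)-x^{\max(LLL(r),LLL(s))}, & \text{if } n=rs \text{ with } r,s\ge 2.\end{cases}$$
   Context: For $m\ge 1$ let $p_m$ denote the $m$-th prime ($p_1=2,p_2=3,p_3=5,\dots$). Rooted trees are finite and considered up to isomorphism of rooted trees. The Matula number $\mu(T)$ of a rooted tree $T$ is defined recursively: $\mu(T)=1$ for the one-vertex tree; otherwise, if $T_1,\dots,T_d$ are the subtrees rooted at the vertices adjacent to the root of $T$, then $\mu(T)=p_{\mu(T_1)}p_{\mu(T_2)}\cdots p_{\mu(T_d)}$. The map $\mu$ is a bijection from rooted trees to positive integers, and $\tau(n)$ denotes the rooted tree with Matula number $n$. Equivalently: $\tau(1)$ is the one-vertex tree; $\tau(p_t)$ is obtained from $\tau(t)$ by adding a new vertex, which becomes the root, joined by an edge to the root of $\tau(t)$; and, for $r,s\ge 2$, $\tau(rs)$ is obtained from $\tau(r)$ and $\tau(s)$ by identifying their roots. For a statistic $S$ on rooted trees, $S(n)$ means $S(\tau(n))$. A leaf of a rooted tree with at least two vertices is a vertex having no children. The exit distance $\lambda(v)$ of a vertex $v$ is the distance from $v$ to the nearest leaf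 that is a descendant of $v$ (a leaf counts as a descendant of itself, so leaves have exit distance $0$). The exit-distance polynomial is $\sum_v x^{\lambda(v)}$, the sum being over all vertices $v$. The level of a vertex is its distance from the root, and $LLL$ is the minimum of the levels of the leaves. For the one-vertex tree the conventions are that its single vertex has exit distance $0$ and $LLL(1)=0$. *)

theory Defs
  imports
    "HOL-Library.Multiset"
    "HOL-Library.Infinite_Set"
    "HOL-Computational_Algebra.Primes"
    "HOL-Computational_Algebra.Polynomial"
begin

text \<open>
  Finite rooted trees up to isomorphism: a tree is determined by the finite multiset of
  (isomorphism classes of) subtrees rooted at the vertices adjacent to the root.
\<close>

datatype rtree = Node (children: "rtree multiset")

text \<open>The primes are indexed from 1, whereas \<^const>\<open>enumerate\<close> starts at 0; the index 0 is irrelevant.\<close>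

definition nth_prime :: "nat \<Rightarrow> nat" where
  "nth_prime m = enumerate {p. prime p} (m - 1)"

primrec matula :: "rtree \<Rightarrow> nat" where
  "matula (Node M) = prod_mset (image_mset nth_prime (image_mset matula M))"

text \<open>
  Well defined for \<open>n \<ge> 1\<close> only, since \<^const>\<open>matula\<close> is a bijection onto the positive integers.
\<close>

definition tau :: "nat \<Rightarrow> rtree" where
  "tau n = (THE T. matula T = n)"

text \<open>
  A tree up to isomorphism has no canonical vertex set. Instead, each vertex \<open>v\<close> of \<open>T\<close>
  contributes one occurrence of the pair \<open>(d, S)\<close> to the multiset \<open>vertices T\<close>, where \<open>d\<close> is
  the level of \<open>v\<close> in \<open>T\<close> and \<open>S\<close> is the subtree formed by \<open>v\<close> and all its descendants,
  rooted at \<open>v\<close>. Distinct vertices with equal pairs are counted with multiplicity.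
\<close>

primrec vertices :: "rtree \<Rightarrow> (nat \<times> rtree) multiset" where
  "vertices (Node M) =
     add_mset (0, Node M) (image_mset (\<lambda>(d, S). (Suc d, S)) (\<Sum>\<^sub># (image_mset vertices M)))"

text \<open>
  The leaves are the vertices without children. This includes the vertex of the one-vertex tree,
  which yields the conventions that it has exit distance 0 and lowest leaf level 0.
\<close>

definition leaf_levels :: "rtree \<Rightarrow> nat set" where
  "leaf_levels T = {d. \<exists>S. (d, S) \<in># vertices T \<and> children S = {#}}"

definition LLL :: "rtree \<Rightarrow> nat" where
  "LLL T = Min (leaf_levels T)"

text \<open>
  The exit distance of a vertex \<open>v\<close>, as a function of the subtree \<open>S\<close> rooted at \<open>v\<close>: the leaves
  that are descendants of \<open>v\<close> are the leaves of \<open>S\<close>, and their distances from \<open>v\<close> are their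
  levels in \<open>S\<close>.
\<close>

definition exit_distance :: "rtree \<Rightarrow> nat" where
  "exit_distance S = Min (leaf_levels S)"

definition EDP :: "rtree \<Rightarrow> int poly" where
  "EDP T = (\<Sum>(d, S)\<in>#vertices T. monom 1 (exit_distance S))"

end

theory Submission
  imports Defs
begin

text \<open>
  The root of a tree is the only vertex whose exit distance is not already determined within one
  of the subtrees hanging from it, so the exit-distance polynomial is \<open>x\<close> to the power of the exit
  distance of the root plus the sum of the polynomials of these subtrees (\<open>EDP_Node\<close>). The exit
  distance of the root is the level of the lowest leaf, by definition, so everything reduces to
  how \<open>LLL\<close> reacts to the two ways of building a tree (\<open>LLL_planted\<close>, \<open>LLL_merge\<close>).
  Hanging a tree below a new root raises all leaves by one level, which gives the prime case.
  Identifying the roots of two trees with at least two vertices unites their sets of leaves, so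
  the new root has exit distance \<open>min a b\<close>, where \<open>a\<close> and \<open>b\<close> are the exit distances of the old
  roots. The contribution \<open>x ^ a + x ^ b = x ^ min a b + x ^ max a b\<close> of the old roots is thus
  replaced by \<open>x ^ min a b\<close>, and only \<open>x ^ max a b\<close> is lost.

  The passage from numbers to trees rests on the bijectivity of the Matula number. Injectivity is
  unique factorisation: the prime factors of the number are the values of \<open>nth_prime\<close> at the
  numbers of the subtrees. Surjectivity is a strong induction, which works because the index of a
  prime is smaller than the prime (\<open>index_less_nth_prime\<close>).
\<close>

section \<open>Indexing the primes\<close>

lemma nth_prime_Suc: "nth_prime (Suc k) = enumerate {p. prime p} k"
  by (simp add: nth_prime_def)

lemma infinite_primes: "infinite {p :: nat. prime p}"
  using primes_infinite by blast

lemma prime_nth_prime: "prime (nth_prime m)"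
  using enumerate_in_set[OF infinite_primes] by (auto simp: nth_prime_def)

lemma nth_prime_inj: "nth_prime a = nth_prime b \<Longrightarrow> a \<ge> 1 \<Longrightarrow> b \<ge> 1 \<Longrightarrow> a = b"
  using strict_mono_enumerate[OF infinite_primes]
  by (cases a; cases b) (auto simp: nth_prime_Suc dest: strict_mono_eq)

text \<open>This makes strong induction available for the prime case of the surjectivity proof.\<close>

lemma index_less_nth_prime: "m < nth_prime m"
proof (cases m)
  case 0
  then show ?thesis using prime_gt_0_nat[OF prime_nth_prime] by simp
next
  case (Suc k)
  have "k + 2 \<le> enumerate {p. prime p} k"
  proof (induction k)
    case 0
    show ?case using prime_ge_2_nat[OF prime_nth_prime[of 1]] by (simp add: nth_prime_def)
  next
    case (Suc k)
    then show ?case using enumerate_step[OF infinite_primes, of k] by linarith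
  qed
  then show ?thesis using Suc by (simp add: nth_prime_Suc)
qed

lemma prime_is_nth_prime:
  assumes "prime p"
  obtains m where "m \<ge> 1" "p = nth_prime m"
proof -
  obtain k where "enumerate {p. prime p} k = p"
    using enumerate_Ex[OF infinite_primes] assms by blast
  then show thesis using that[of "Suc k"] by (simp add: nth_prime_Suc)
qed

section \<open>Bijectivity of the Matula number\<close>

lemma matula_pos: "matula T \<ge> 1"
proof (cases T)
  case (Node M)
  have nz: "nth_prime m \<noteq> 0" for m
    using prime_nth_prime[of m] not_prime_0 by metis
  have "matula T \<noteq> 0"
    using Node by (auto simp: prod_mset_zero_iff nz)
  then show ?thesis by simp
qed

lemma prime_factorization_matula:
  "prime_factorization (matula (Node M)) = image_mset (\<lambda>T. nth_prime (matula T)) M"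
proof -
  have "prime_factorization (prod_mset (image_mset (\<lambda>T. nth_prime (matula T)) M))
      = image_mset (\<lambda>T. nth_prime (matula T)) M"
    by (rule prime_factorization_prod_mset_primes) (auto simp: prime_nth_prime)
  then show ?thesis by (simp add: image_mset.compositionality comp_def)
qed

text \<open>
  Since a multiset of primes is determined by its product, equal Matula numbers give equal
  multisets of numbers of the children; by induction these numbers determine the children.
\<close>

lemma matula_inj: "matula S = matula T \<Longrightarrow> S = T"
proof (induction S arbitrary: T)
  case (Node M)
  obtain N where T: "T = Node N" by (cases T)
  have eq: "image_mset (\<lambda>T. nth_prime (matula T)) M = image_mset (\<lambda>T. nth_prime (matula T)) N"
    by (simp only: Node.prems[unfolded T] flip: prime_factorization_matula)
  have inj: "A = B" if "A \<in># M" "nth_prime (matula A) = nth_prime (matula B)" for A B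
    by (rule Node.IH[OF that(1) nth_prime_inj[OF that(2) matula_pos matula_pos]])
  have "M = N"
    by (rule multiset.inj_map_strong[OF _ eq]) (rule inj)
  then show ?case using T by simp
qed

lemma tau_matula: "tau (matula T) = T"
  unfolding tau_def using matula_inj by blast

lemma tau_eqI: "matula T = n \<Longrightarrow> tau n = T"
  using tau_matula by blast

lemma matula_leaf: "matula (Node {#}) = 1"
  by simp

lemma matula_planted: "matula (Node {#T#}) = nth_prime (matula T)"
  by simp

lemma matula_merge: "matula (Node (M + N)) = matula (Node M) * matula (Node N)"
  by simp

lemma matula_surj: "n \<ge> 1 \<Longrightarrow> \<exists>T. matula T = n"
proof (induction n rule: less_induct)
  case (less n)
  show ?case
  proof (cases "n = 1")
    case True
    then show ?thesis using matula_leaf by blast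
  next
    case False
    then obtain p where p: "prime p" "p dvd n" using prime_factor_nat by blast
    then obtain k where k: "n = p * k" by auto
    show ?thesis
    proof (cases "k = 1")
      case True
      obtain t where t: "t \<ge> 1" "p = nth_prime t" using p prime_is_nth_prime by blast
      then have "t < n" using index_less_nth_prime k True by simp
      then obtain T where "matula T = t" using less.IH t by blast
      then show ?thesis using matula_planted t k True by (metis mult.right_neutral)
    next
      case False
      have "p \<ge> 2" "k \<ge> 2" using False k less.prems prime_ge_2_nat[OF p(1)] by (cases k; auto)+
      then have "p < n" "k < n" using k by auto
      then obtain A B where "matula A = p" "matula B = k"
        using less.IH \<open>p \<ge> 2\<close> \<open>k \<ge> 2\<close> by (metis One_nat_def Suc_1 Suc_leD)
      then show ?thesis using matula_merge k by (metis rtree.exhaust)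
    qed
  qed
qed

lemma matula_tau: "n \<ge> 1 \<Longrightarrow> matula (tau n) = n"
  using matula_surj tau_matula by metis

lemma children_tau_nonempty: "n \<ge> 2 \<Longrightarrow> children (tau n) \<noteq> {#}"
  using matula_tau[of n] matula_leaf by (cases "tau n") auto

lemma tau_1: "tau 1 = Node {#}"
  by (rule tau_eqI) simp

lemma tau_nth_prime: "t \<ge> 1 \<Longrightarrow> tau (nth_prime t) = Node {#tau t#}"
  by (rule tau_eqI) (simp add: matula_tau)

lemma tau_mult:
  assumes "r \<ge> 1" "s \<ge> 1"
  shows "tau (r * s) = Node (children (tau r) + children (tau s))"
  using assms by (intro tau_eqI) (simp only: matula_merge rtree.collapse matula_tau)

section \<open>Leaf levels\<close>

lemma leaf_levels_leaf: "leaf_levels (Node {#}) = {0}"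
  by (auto simp: leaf_levels_def)

lemma leaf_levels_Node:
  "M \<noteq> {#} \<Longrightarrow> leaf_levels (Node M) = Suc ` (\<Union>T\<in>set_mset M. leaf_levels T)"
  by (force simp: leaf_levels_def)

lemma finite_leaf_levels: "finite (leaf_levels T)"
proof -
  have "leaf_levels T \<subseteq> fst ` set_mset (vertices T)"
    by (force simp: leaf_levels_def)
  then show ?thesis using finite_surj by blast
qed

lemma leaf_levels_nonempty: "leaf_levels T \<noteq> {}"
proof (induction T)
  case (Node M)
  then show ?case
    by (cases "M = {#}") (auto simp: leaf_levels_leaf leaf_levels_Node)
qed

lemma LLL_leaf: "LLL (Node {#}) = 0"
  by (simp add: LLL_def leaf_levels_leaf)

lemma LLL_planted: "LLL (Node {#T#}) = 1 + LLL T"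
  using mono_Min_commute[of Suc "leaf_levels T"]
  by (simp add: LLL_def leaf_levels_Node finite_leaf_levels leaf_levels_nonempty mono_Suc)

text \<open>
  Both multisets have to be nonempty: the root of a one-vertex tree is a leaf at level 0, and it
  stops being a leaf when something is attached to it.
\<close>

lemma LLL_merge:
  assumes "M \<noteq> {#}" "N \<noteq> {#}"
  shows "LLL (Node (M + N)) = min (LLL (Node M)) (LLL (Node N))"
proof -
  have "leaf_levels (Node (M + N)) = leaf_levels (Node M) \<union> leaf_levels (Node N)"
    using assms by (auto simp: leaf_levels_Node)
  then show ?thesis
    by (simp add: LLL_def Min_Un finite_leaf_levels leaf_levels_nonempty)
qed

section \<open>The exit-distance polynomial\<close>

text \<open>
  The exit distance of a vertex depends only on the subtree below it, so it does not change when
  the levels are shifted by passing to a larger tree.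
\<close>

lemma EDP_Node: "EDP (Node M) = monom 1 (LLL (Node M)) + (\<Sum>T\<in>#M. EDP T)"
proof -
  have "(\<Sum>v\<in>#\<Sum>\<^sub># (image_mset vertices M). monom (1 :: int) (exit_distance (snd v)))
      = (\<Sum>T\<in>#M. EDP T)"
    by (induction M) (simp_all add: EDP_def case_prod_unfold)
  then show ?thesis
    by (simp add: EDP_def[of "Node M"] exit_distance_def LLL_def image_mset.compositionality
        comp_def case_prod_unfold)
qed

lemma EDP_leaf: "EDP (Node {#}) = 1"
  by (simp add: EDP_Node LLL_leaf)

lemma EDP_planted: "EDP (Node {#T#}) = EDP T + monom 1 (1 + LLL T)"
  by (simp add: EDP_Node LLL_planted)

lemma EDP_merge:
  assumes "M \<noteq> {#}" "N \<noteq> {#}"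
  shows "EDP (Node (M + N)) = EDP (Node M) + EDP (Node N)
    - monom 1 (max (LLL (Node M)) (LLL (Node N)))"
proof -
  (* The contributions of the two old roots, regrouped so that that of the new root appears. *)
  have "monom (1 :: int) a + monom 1 b = monom 1 (min a b) + monom 1 (max a b)" for a b
    by (simp add: min_def max_def)
  from this[of "LLL (Node M)" "LLL (Node N)"] show ?thesis
    by (simp add: EDP_Node LLL_merge[OF assms] algebra_simps)
qed

theorem proposition3p28:
  fixes n :: nat
  assumes "n \<ge> 1"
  shows "(n = 1 \<longrightarrow> EDP (tau n) = 1) \<and>
         (\<forall>t\<ge>1. n = nth_prime t \<longrightarrow>
            EDP (tau n) = EDP (tau t) + monom 1 (1 + LLL (tau t))) \<and>
         (\<forall>r\<ge>2. \<forall>s\<ge>2. n = r * s \<longrightarrow>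
            EDP (tau n) = EDP (tau r) + EDP (tau s)
              - monom 1 (max (LLL (tau r)) (LLL (tau s))))"
proof (intro conjI allI impI)
  assume "n = 1"
  then show "EDP (tau n) = 1" by (simp only: tau_1 EDP_leaf)
next
  fix t :: nat assume "t \<ge> 1" "n = nth_prime t"
  then show "EDP (tau n) = EDP (tau t) + monom 1 (1 + LLL (tau t))"
    by (simp only: tau_nth_prime EDP_planted)
next
  fix r s :: nat assume "r \<ge> 2" "s \<ge> 2" "n = r * s"
  then show "EDP (tau n) = EDP (tau r) + EDP (tau s)
      - monom 1 (max (LLL (tau r)) (LLL (tau s)))"
    using EDP_merge[OF children_tau_nonempty children_tau_nonempty, of r s] tau_mult[of r s]
    by simp
qed

end
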